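(* Let $L$ be a lattice such that each nonempty upper bounded subset of $L$ has a join. Assume that there is an order-preserving increasing action of $\mathbb Z$ on $L$, written additively, such that $$\forall x,y\in L,\ \exists k\in\mathbb N,\quad x-k\le y\le x+k.$$ Let $X$ be the graph with vertex set $L$, with an edge between distinct $x,y\in L$ if $x\le y\le x+1$ or $y\le x\le y+1$. Then $X$ is a weakly modular graph.
   Context: The image of $x\in L$ under $n\in\mathbb Z$ is denoted $x+n$; the action is increasing in the sense that $x\le x+1$ for all $x\in L$. $\mathbb N$ contains $0$. A simplicial graph $\Gamma$ is endowed with the path metric $d$ in which every edge has length $1$. $\Gamma$ is weakly modular if for every vertex $x$ of $\Gamma$ and every integer $n\geq 2$ the following hold. (Triangle condition) For any two adjacent vertices $x_1,x_2$ with $d(x,x_1)=d(x,x_2)=n$, there is a vertex $y$ with $d(y,x)=n-1$ and $d(y,x_1)=d(y,x_2)=1$. (Quadrangle condition) For any two vertices $x_1,x_2$ with $d(x,x_1)=d(x,x_2)=n$ and $d(x_1,x_2)=2$ such that $x_1,x_2$ are both adjacent to a common vertex at distance $n+1$ from $x$, there is a vertex $y$ with $d(y,x)=n-1$ and $d(y,x_1)=d(y,x_2)=1$. *)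

theory Defs
  imports Main "HOL-Library.Extended_Nat" "HOL-Library.Lub_Glb"
begin

text \<open>The vertex set of a graph is a whole type, and its edges are given by an adjacency relation.\<close>

definition simplicial_graph :: "('a \<Rightarrow> 'a \<Rightarrow> bool) \<Rightarrow> bool" where
  "simplicial_graph adj \<longleftrightarrow> symp adj \<and> irreflp adj"

text \<open>The relation \<open>adj ^^ n\<close> holds between the endpoints of the edge paths of length \<open>n\<close>, so
  the infimum below is \<open>\<infinity>\<close> exactly when no edge path joins the two vertices.\<close>

definition path_dist :: "('a \<Rightarrow> 'a \<Rightarrow> bool) \<Rightarrow> 'a \<Rightarrow> 'a \<Rightarrow> enat" where
  "path_dist adj x y = (INF n \<in> {n. (adj ^^ n) x y}. enat n)"

definition triangle_condition :: "('a \<Rightarrow> 'a \<Rightarrow> bool) \<Rightarrow> bool" where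
  "triangle_condition adj \<longleftrightarrow>
    (\<forall>x. \<forall>n::nat\<ge>2. \<forall>x1 x2.
       adj x1 x2 \<and> path_dist adj x x1 = enat n \<and> path_dist adj x x2 = enat n \<longrightarrow>
       (\<exists>y. path_dist adj y x = enat (n - 1) \<and>
            path_dist adj y x1 = 1 \<and> path_dist adj y x2 = 1))"

definition quadrangle_condition :: "('a \<Rightarrow> 'a \<Rightarrow> bool) \<Rightarrow> bool" where
  "quadrangle_condition adj \<longleftrightarrow>
    (\<forall>x. \<forall>n::nat\<ge>2. \<forall>x1 x2.
       path_dist adj x x1 = enat n \<and> path_dist adj x x2 = enat n \<and>
       path_dist adj x1 x2 = 2 \<and>
       (\<exists>z. adj x1 z \<and> adj x2 z \<and> path_dist adj x z = enat (n + 1)) \<longrightarrow>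
       (\<exists>y. path_dist adj y x = enat (n - 1) \<and>
            path_dist adj y x1 = 1 \<and> path_dist adj y x2 = 1))"

text \<open>The finiteness clause says that the graph is connected, that is, that the path metric is a
  metric in the strict sense.\<close>

definition weakly_modular_graph :: "('a \<Rightarrow> 'a \<Rightarrow> bool) \<Rightarrow> bool" where
  "weakly_modular_graph adj \<longleftrightarrow>
    simplicial_graph adj \<and> (\<forall>x y. path_dist adj x y < \<infinity>) \<and>
    triangle_condition adj \<and> quadrangle_condition adj"

definition int_action :: "('a \<Rightarrow> int \<Rightarrow> 'a) \<Rightarrow> bool" where
  "int_action act \<longleftrightarrow>
    (\<forall>x. act x 0 = x) \<and> (\<forall>x m n. act (act x m) n = act x (m + n))"

definition interval_adj :: "('a::order \<Rightarrow> int \<Rightarrow> 'a) \<Rightarrow> 'a \<Rightarrow> 'a \<Rightarrow> bool" where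
  "interval_adj act x y \<longleftrightarrow>
    x \<noteq> y \<and> (x \<le> y \<and> y \<le> act x 1 \<or> y \<le> x \<and> x \<le> act y 1)"

end

theory Submission
  imports Defs
begin

text \<open>
  Let \<open>height x y\<close> be the least natural number \<open>k\<close> with \<open>y \<le> x + k\<close>. Truncating with
  \<open>x + i\<close> shows that an interval \<open>x \<le> z \<le> x + k\<close> can be climbed in \<open>k\<close> steps, and going from
  \<open>x\<close> to \<open>y\<close> through their join gives \<open>d(x, y) = height x y + height y x\<close>. Both conditions then
  amount to finding a neighbour \<open>y\<close> of \<open>x1\<close> and \<open>x2\<close> with one of its two heights relative to \<open>x\<close>
  lowered; cutting off \<open>x1\<close> and \<open>x2\<close> by a suitable translate of \<open>x\<close> provides it.
\<close>

section \<open>Path distance in an arbitrary graph\<close>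

lemma relpowp_symp:
  assumes "symp R" "(R ^^ n) x y"
  shows "(R ^^ n) y x"
  using assms(2)
proof (induction n arbitrary: y)
  case (Suc n)
  then obtain z where "(R ^^ n) x z" "R z y" by auto
  with Suc.IH assms(1) have "(R ^^ n) z x" "R y z" by (auto dest: sympD)
  then show ?case by (rule relpowp_Suc_I2[rotated])
qed auto

text \<open>The lower bound applies to the given path itself and turns \<open>m \<le> n\<close> into
  an equality, so a constructed path only needs an upper bound on its length.\<close>

lemma path_dist_eqI:
  assumes "(adj ^^ m) x y" "m \<le> n" "\<And>k. (adj ^^ k) x y \<Longrightarrow> n \<le> k"
  shows "path_dist adj x y = enat n"
proof -
  have "m = n" using assms by (simp add: le_antisym)
  with assms show ?thesis
    unfolding path_dist_def by (intro antisym INF_greatest INF_lower) auto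
qed

lemma path_dist_adj:
  assumes "irreflp adj" "adj x y"
  shows "path_dist adj x y = 1"
proof -
  have "1 \<le> k" if "(adj ^^ k) x y" for k
    using that assms by (cases k) (auto dest: irreflpD)
  with assms(2) have "path_dist adj x y = enat 1"
    by (intro path_dist_eqI[where m = 1]) (auto simp: relpowp_1)
  then show ?thesis by (simp add: one_enat_def)
qed

section \<open>Translations as lattice automorphisms\<close>

locale lattice_int_action =
  fixes act :: "'a::lattice \<Rightarrow> int \<Rightarrow> 'a" (infixl "\<oplus>" 65)
  assumes action: "int_action (\<oplus>)"
    and order_preserving: "\<And>n. mono (\<lambda>x. x \<oplus> n)"
    and increasing: "\<And>x. x \<le> x \<oplus> 1"
    and cofinal: "\<And>x y. \<exists>k::nat. x \<oplus> (- int k) \<le> y \<and> y \<le> x \<oplus> int k"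
begin

lemma act_0 [simp]: "x \<oplus> 0 = x"
  and act_act [simp]: "x \<oplus> m \<oplus> n = x \<oplus> (m + n)"
  using action by (auto simp: int_action_def)

lemma act_mono: "x \<le> y \<Longrightarrow> x \<oplus> n \<le> y \<oplus> n"
  using order_preserving by (auto dest: monoD)

text \<open>Translation by \<open>- m\<close> is monotone and inverts translation by
  \<open>m\<close>. As simp rules, this and \<open>act_le_iff\<close> collect all shifts on the
  right-hand side.\<close>

lemma act_le_act_iff [simp]: "x \<oplus> m \<le> y \<oplus> n \<longleftrightarrow> x \<le> y \<oplus> (n - m)"
  using act_mono[of "x \<oplus> m" "y \<oplus> n" "- m"] act_mono[of x "y \<oplus> (n - m)" m] by auto

lemma act_le_iff [simp]: "x \<oplus> m \<le> y \<longleftrightarrow> x \<le> y \<oplus> (- m)"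
  using act_le_act_iff[of x m y 0] by simp

lemma le_act_nat: "x \<le> x \<oplus> int k"
proof (induction k)
  case (Suc k)
  also have "x \<oplus> int k \<le> x \<oplus> int (Suc k)" using increasing[of x] by simp
  finally show ?case .
qed simp

lemma le_act_mono:
  assumes "x \<le> y \<oplus> m" "m \<le> n"
  shows "x \<le> y \<oplus> n"
proof -
  have "y \<oplus> m \<le> y \<oplus> n" using le_act_nat[of y "nat (n - m)"] assms(2) by simp
  with assms(1) show ?thesis by (rule order_trans)
qed

lemma le_act_nonneg: "x \<le> y \<Longrightarrow> 0 \<le> n \<Longrightarrow> x \<le> y \<oplus> n"
  using le_act_mono[of x y 0 n] by simp

lemma le_act_trans: "x \<le> y \<oplus> m \<Longrightarrow> y \<le> z \<oplus> n \<Longrightarrow> m + n \<le> k \<Longrightarrow> x \<le> z \<oplus> k"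
  using act_mono[of y "z \<oplus> n" m] le_act_mono[of x z "n + m" k]
  by (simp del: act_le_act_iff add: add.commute order_trans)

lemma act_inf: "inf x y \<oplus> n = inf (x \<oplus> n) (y \<oplus> n)"
proof (rule antisym)
  have "inf (x \<oplus> n) (y \<oplus> n) \<oplus> (- n) \<le> inf x y"
    using act_mono[of "inf (x \<oplus> n) (y \<oplus> n)" "x \<oplus> n" "- n"]
      act_mono[of "inf (x \<oplus> n) (y \<oplus> n)" "y \<oplus> n" "- n"]
    by (simp del: act_le_act_iff act_le_iff)
  then show "inf (x \<oplus> n) (y \<oplus> n) \<le> inf x y \<oplus> n" by (simp only: act_le_iff minus_minus)
qed (simp del: act_le_act_iff act_le_iff add: act_mono)

lemma le_inf_act_iff [simp]: "x \<le> inf y z \<oplus> n \<longleftrightarrow> x \<le> y \<oplus> n \<and> x \<le> z \<oplus> n"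
  by (simp add: act_inf)

lemma act_sup [simp]: "sup x y \<oplus> n = sup (x \<oplus> n) (y \<oplus> n)"
proof (rule antisym)
  have "sup x y \<le> sup (x \<oplus> n) (y \<oplus> n) \<oplus> (- n)"
    using act_mono[of "x \<oplus> n" "sup (x \<oplus> n) (y \<oplus> n)" "- n"]
      act_mono[of "y \<oplus> n" "sup (x \<oplus> n) (y \<oplus> n)" "- n"] by simp
  then show "sup x y \<oplus> n \<le> sup (x \<oplus> n) (y \<oplus> n)" by (simp only: act_le_iff)
qed (simp del: act_le_act_iff act_le_iff add: act_mono)

section \<open>Height as an asymmetric distance\<close>

definition height :: "'a \<Rightarrow> 'a \<Rightarrow> nat" where
  "height x y = (LEAST k. y \<le> x \<oplus> int k)"

text \<open>Cofinality makes the least \<open>k\<close> exist, and \<open>x \<oplus> int k\<close>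
  grows with \<open>k\<close>.\<close>

lemma height_le_iff: "height x y \<le> k \<longleftrightarrow> y \<le> x \<oplus> int k"
proof
  have "y \<le> x \<oplus> int (height x y)"
    unfolding height_def using cofinal[of x y] by (auto intro: LeastI)
  then show "height x y \<le> k \<Longrightarrow> y \<le> x \<oplus> int k" by (rule le_act_mono) simp
qed (simp add: height_def Least_le)

lemma le_height: "y \<le> x \<oplus> int (height x y)"
  using height_le_iff by blast

lemma height_triangle: "height x z \<le> height x y + height y z"
  unfolding height_le_iff using le_height[of z y] le_height[of y x] by (rule le_act_trans) simp

lemma height_eq_0_iff: "height x y = 0 \<longleftrightarrow> y \<le> x"
  using height_le_iff[of x y 0] by simp

section \<open>Graph distance as symmetrized height\<close>

abbreviation adj :: "'a \<Rightarrow> 'a \<Rightarrow> bool" where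
  "adj \<equiv> interval_adj (\<oplus>)"

lemma symp_adj: "symp adj" and irreflp_adj: "irreflp adj"
  by (auto simp: interval_adj_def intro: sympI irreflpI)

lemma adj_height: "adj x y \<Longrightarrow> height x y + height y x \<le> 1"
  using height_le_iff[of x y 1] height_le_iff[of y x 1] height_eq_0_iff[of x y]
    height_eq_0_iff[of y x]
  by (auto simp: interval_adj_def)

text \<open>Both heights are subadditive and an edge adds at most 1 to their sum; this is the lower
  bound for the distance.\<close>

lemma relpowp_adj_height: "(adj ^^ n) x y \<Longrightarrow> height x y + height y x \<le> n"
proof (induction n arbitrary: y)
  case 0
  then show ?case by (simp add: height_eq_0_iff)
next
  case (Suc n)
  then obtain z where "(adj ^^ n) x z" "adj z y" by auto
  then show ?case
    using Suc.IH[of z] adj_height[of z y] height_triangle[of x y z] height_triangle[of y x z]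
    by simp
qed

lemma ex_relpowp_adj: "x \<le> z \<Longrightarrow> z \<le> x \<oplus> int k \<Longrightarrow> \<exists>m\<le>k. (adj ^^ m) x z"
proof (induction k arbitrary: z)
  case (Suc k)
  \<comment> \<open>\<open>w\<close> stays in the interval of length \<open>k\<close>, with
    \<open>z\<close> at most one step above it. Truncation may leave \<open>z\<close> fixed, so path
    lengths are only bounded.\<close>
  define w where "w = inf z (x \<oplus> int k)"
  have "x \<le> w" using Suc.prems le_act_nat by (simp add: w_def)
  then obtain m where m: "m \<le> k" "(adj ^^ m) x w"
    using Suc.IH[of w] by (auto simp: w_def)
  have "w \<le> z" "z \<le> w \<oplus> 1"
    using Suc.prems increasing[of z] by (auto simp: w_def add.commute)
  then have "w = z \<or> adj w z" by (auto simp: interval_adj_def)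
  with m show ?case by (metis Suc_le_mono le_SucI relpowp_Suc_I)
qed auto

lemma path_dist_height: "path_dist adj x y = enat (height x y + height y x)"
proof -
  \<comment> \<open>The path climbs from \<open>x\<close> to the join and descends to
    \<open>y\<close> along a reversed climb. Writing \<open>sup y x\<close> makes the second bound
    the first with \<open>x\<close> and \<open>y\<close> swapped.\<close>
  have "sup x y \<le> x \<oplus> int (height x y)" "sup y x \<le> y \<oplus> int (height y x)"
    by (auto intro: le_height le_act_nat)
  from this[THEN ex_relpowp_adj[rotated]] obtain m n
    where "m \<le> height x y" "(adj ^^ m) x (sup x y)"
      and "n \<le> height y x" "(adj ^^ n) y (sup y x)" by auto
  moreover from this have "(adj ^^ (m + n)) x y"
    using relpowp_symp[OF symp_adj, of n y] by (auto simp: relpowp_add sup.commute)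
  ultimately show ?thesis
    by (intro path_dist_eqI[where m = "m + n"] add_mono relpowp_adj_height)
qed

text \<open>The bounds on \<open>y\<close> force \<open>d(x, y) < n\<close>, so \<open>y\<close> differs from \<open>x1\<close> and \<open>x2\<close>, and the triangle
  inequality gives \<open>d(x, y) = n - 1\<close>.\<close>

lemma common_neighbour:
  assumes dist: "height x x1 + height x1 x = n" "height x x2 + height x2 x = n"
    and close: "y \<le> x1 \<and> x1 \<le> y \<oplus> 1 \<or> x1 \<le> y \<and> y \<le> x1 \<oplus> 1"
      "y \<le> x2 \<and> x2 \<le> y \<oplus> 1 \<or> x2 \<le> y \<and> y \<le> x2 \<oplus> 1"
    and bounds: "y \<le> x \<oplus> int a" "x \<le> y \<oplus> int b" "a + b < n"
  shows "\<exists>y. path_dist adj y x = enat (n - 1) \<and> path_dist adj y x1 = 1 \<and> path_dist adj y x2 = 1"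
proof -
  have less: "height x y + height y x < n"
    using bounds height_le_iff[of x y a] height_le_iff[of y x b] by linarith
  with dist close have adj: "adj y x1" "adj y x2" by (auto simp: interval_adj_def)
  have "height x y + height y x = n - 1"
    using less dist(1) adj_height[OF adj(1)] height_triangle[of x x1 y] height_triangle[of x1 x y]
    by linarith
  then have "path_dist adj y x = enat (n - 1)" by (simp add: path_dist_height add.commute)
  with adj show ?thesis by (blast intro: path_dist_adj[OF irreflp_adj])
qed

text \<open>Triangle inequalities through an upward edge, whose two heights are at most 1 and 0.
  They pin down how the heights relative to \<open>w\<close> change along it.\<close>

lemma height_step:
  assumes "x \<le> y" "y \<le> x \<oplus> 1"
  shows "height w x \<le> height w y" "height w y \<le> height w x + 1"
    "height y w \<le> height x w" "height x w \<le> height y w + 1"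
proof -
  have "height x y \<le> 1" "height y x = 0"
    using assms height_le_iff[of x y 1] by (auto simp: height_eq_0_iff)
  then show "height w x \<le> height w y" "height w y \<le> height w x + 1"
    "height y w \<le> height x w" "height x w \<le> height y w + 1"
    using height_triangle[of w x y] height_triangle[of w y x] height_triangle[of x w y]
      height_triangle[of y w x] by linarith+
qed

section \<open>Triangle condition\<close>

lemma triangle_up:
  assumes dist: "height x x1 + height x1 x = n" "height x x2 + height x2 x = n"
    and "x1 \<le> x2" "x2 \<le> x1 \<oplus> 1" "n \<ge> 2"
  shows "\<exists>y. path_dist adj y x = enat (n - 1) \<and> path_dist adj y x1 = 1 \<and> path_dist adj y x2 = 1"
proof -
  note le1 = le_height[of x1 x] le_height[of x x1] and le2 = le_height[of x2 x] le_height[of x x2]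
  \<comment> \<open>Equal sums force the two heights to change together along the edge: both by one,
    or neither.\<close>
  from height_step[OF \<open>x1 \<le> x2\<close> \<open>x2 \<le> x1 \<oplus> 1\<close>, of x] consider "height x x2 = height x x1 + 1" "height x1 x = height x2 x + 1"
    | "height x x2 = height x x1" "height x2 x = height x1 x" "height x x1 > 0"
    | "height x x2 = height x x1" "height x2 x = height x1 x" "height x x1 = 0" "height x1 x > 0"
    using dist \<open>n \<ge> 2\<close> by linarith
  then show ?thesis
  proof cases
    case 1
    \<comment> \<open>The cut lies between \<open>x1\<close> and \<open>x2\<close> and combines the
      smaller upper height, that of \<open>x1\<close>, with the smaller lower height, that of
      \<open>x2\<close>.\<close>
    show ?thesis
      by (rule common_neighbour[where y = "inf x2 (x \<oplus> int (height x x1))"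
            and a = "height x x1" and b = "height x2 x"])
        (use assms 1 le1 le2 in \<open>auto intro: le_infI1 le_act_nonneg simp: add.commute\<close>)
  next
    case 2
    \<comment> \<open>Cutting the lower vertex \<open>x1\<close> keeps \<open>y\<close> below both
      and lowers the upper height by one.\<close>
    show ?thesis
      by (rule common_neighbour[where y = "inf x1 (x \<oplus> (int (height x x1) - 1))"
            and a = "height x x1 - 1" and b = "height x1 x"])
        (use assms 2 le1 le2 in \<open>auto intro: le_infI1 le_act_nonneg simp: of_nat_diff\<close>)
  next
    case 3
    \<comment> \<open>Here both vertices lie below \<open>x\<close>, so only the other height can
      drop: \<open>y\<close> is raised towards \<open>x\<close>, but not above it.\<close>
    show ?thesis
      by (rule common_neighbour[where y = "sup x2 (x \<oplus> (1 - int (height x1 x)))"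
            and a = 0 and b = "height x1 x - 1"])
        (use assms 3 le1 le2 in \<open>auto intro: le_supI1 le_act_nonneg simp: of_nat_diff\<close>)
  qed
qed

section \<open>Quadrangle condition\<close>

lemma quadrangle_below:
  assumes dist: "height x x1 + height x1 x = n" "height x x2 + height x2 x = n"
      "height x z + height z x = n + 1"
    and le: "x1 \<le> z" "z \<le> x1 \<oplus> 1" "x2 \<le> z" "z \<le> x2 \<oplus> 1" and "n \<ge> 2"
  shows "\<exists>y. path_dist adj y x = enat (n - 1) \<and> path_dist adj y x1 = 1 \<and> path_dist adj y x2 = 1"
proof -
  define a b where "a = height x z" and "b = height z x"
  \<comment> \<open>Descending from \<open>z\<close> cannot raise \<open>height x z\<close> or lower
    \<open>height z x\<close>; a total drop of one must therefore come from the first alone.\<close>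
  have h: "height x x1 = a - 1" "height x x2 = a - 1" "height x1 x = b" "height x2 x = b" "a \<ge> 1"
    "a + b = n + 1"
    using height_step[OF le(1,2), of x] height_step[OF le(3,4), of x] dist
    by (auto simp: a_def b_def)
  note bds = le_height[of z x] le_height[of x1 x] le_height[of x2 x]
    le_height[of x z] le_height[of x x1] le_height[of x x2]
  have close: "x1 \<le> x2 \<oplus> 1" "x2 \<le> x1 \<oplus> 1"
    using le by (auto intro: order_trans)
  show ?thesis
  proof (cases "a \<ge> 2")
    case True
    \<comment> \<open>Both vertices have upper height \<open>a - 1\<close>, so the cut at
      \<open>a - 2\<close> lowers it by exactly one step.\<close>
    show ?thesis
      by (rule common_neighbour[where y = "inf (inf x1 x2) (x \<oplus> (int a - 2))"
            and a = "a - 2" and b = b])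
        (use assms(1,2) True h close bds[folded a_def b_def, unfolded h] in
          \<open>auto intro: le_infI1 le_act_nonneg increasing simp: of_nat_diff\<close>)
  next
    case False
    then have "a = 1" "b = n" using h by auto
    \<comment> \<open>With \<open>a = 1\<close> both vertices are below \<open>x\<close>, and the
      join is raised towards \<open>x\<close> instead.\<close>
    show ?thesis
      by (rule common_neighbour[where y = "sup (sup x1 x2) (x \<oplus> (1 - int b))"
            and a = 0 and b = "b - 1"])
        (use assms(1,2) \<open>n \<ge> 2\<close> \<open>a = 1\<close> \<open>b = n\<close> h close bds[folded a_def b_def, unfolded h] in
          \<open>auto intro: le_supI1 le_act_nonneg increasing simp: of_nat_diff\<close>)
  qed
qed

lemma quadrangle_above:
  assumes dist: "height x x1 + height x1 x = n" "height x x2 + height x2 x = n"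
      "height x z + height z x = n + 1"
    and le: "z \<le> x1" "x1 \<le> z \<oplus> 1" "z \<le> x2" "x2 \<le> z \<oplus> 1" and "n \<ge> 2"
  shows "\<exists>y. path_dist adj y x = enat (n - 1) \<and> path_dist adj y x1 = 1 \<and> path_dist adj y x2 = 1"
proof -
  define a b where "a = height x z" and "b = height z x"
  have h: "height x x1 = a" "height x x2 = a" "height x1 x = b - 1" "height x2 x = b - 1" "b \<ge> 1"
    "a + b = n + 1"
    using height_step[OF le(1,2), of x] height_step[OF le(3,4), of x] dist
    by (auto simp: a_def b_def)
  note bds = le_height[of z x] le_height[of x1 x] le_height[of x2 x]
    le_height[of x z] le_height[of x x1] le_height[of x x2]
  have close: "x1 \<le> x2 \<oplus> 1" "x2 \<le> x1 \<oplus> 1"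
    using le by (auto intro: le_act_trans[of _ z 1 _ 0])
  show ?thesis
  proof (cases "b \<ge> 2")
    case True
    \<comment> \<open>Order dual of the cut from above: both vertices have lower height
      \<open>b - 1\<close>, and \<open>y\<close> attains \<open>b - 2\<close>.\<close>
    show ?thesis
      by (rule common_neighbour[where y = "sup (sup x1 x2) (x \<oplus> (2 - int b))"
            and a = a and b = "b - 2"])
        (use assms(1,2) True h close bds[folded a_def b_def, unfolded h] in
          \<open>auto intro: le_supI1 le_act_nonneg increasing simp: of_nat_diff\<close>)
  next
    case False
    then have "b = 1" "a = n" using h by auto
    show ?thesis
      by (rule common_neighbour[where y = "inf (inf x1 x2) (x \<oplus> (int a - 1))"
            and a = "a - 1" and b = 0])
        (use assms(1,2) \<open>n \<ge> 2\<close> \<open>b = 1\<close> \<open>a = n\<close> h close bds[folded a_def b_def, unfolded h] in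
          \<open>auto intro: le_infI1 le_act_nonneg increasing simp: of_nat_diff\<close>)
  qed
qed

lemma quadrangle_between:
  assumes dist: "height x x1 + height x1 x = n" "height x x2 + height x2 x = n"
      "height x z + height z x = n + 1"
    and le: "x1 \<le> z" "z \<le> x1 \<oplus> 1" "z \<le> x2" "x2 \<le> z \<oplus> 1"
  shows "\<exists>y. path_dist adj y x = enat (n - 1) \<and> path_dist adj y x1 = 1 \<and> path_dist adj y x2 = 1"
proof -
  define a b where "a = height x z" and "b = height z x"
  have h: "height x x1 = a - 1" "height x x2 = a" "height x1 x = b" "height x2 x = b - 1"
    "a \<ge> 1" "b \<ge> 1" "a + b = n + 1"
    using height_step[OF le(1,2), of x] height_step[OF le(3,4), of x] dist
    by (auto simp: a_def b_def)
  note bds = le_height[of x1 x] le_height[of x2 x] le_height[of x x1] le_height[of x x2]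
  have "x1 \<le> x2" using le(1,3) by (rule order_trans)
  moreover have "x2 \<le> x1 \<oplus> 2" using le(4,2) by (rule le_act_trans) simp
  \<comment> \<open>\<open>x1\<close> has upper height \<open>a - 1\<close> and \<open>x2\<close>
    has lower height \<open>b - 1\<close>; \<open>y\<close> lies between them and achieves both. The
    bound \<open>x1 \<oplus> 1\<close> keeps it adjacent to \<open>x1\<close>, and
    \<open>x2 \<le> x1 \<oplus> 2\<close> keeps \<open>x2\<close> within one step.\<close>
  ultimately show ?thesis
    by (intro common_neighbour[where y = "inf (inf x2 (x1 \<oplus> 1)) (x \<oplus> (int a - 1))"
          and a = "a - 1" and b = "b - 1"])
      (use assms(1,2) h bds[unfolded h] in
        \<open>auto intro: le_infI1 le_infI2 le_act_nonneg increasing simp: of_nat_diff\<close>)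
qed

lemma weakly_modular: "weakly_modular_graph adj"
proof -
  let ?G = "\<lambda>x x1 x2 n. \<exists>y. path_dist adj y x = enat (n - 1) \<and> path_dist adj y x1 = 1 \<and>
    path_dist adj y x2 = 1"
  have "?G x x1 x2 n"
    if "n \<ge> 2" "adj x1 x2" "path_dist adj x x1 = enat n" "path_dist adj x x2 = enat n"
    for x x1 x2 n
    using that triangle_up[of x x1 n x2] triangle_up[of x x2 n x1]
    unfolding path_dist_height[of x] interval_adj_def by auto
  \<comment> \<open>The common neighbour \<open>z\<close> is above both vertices, below both, or
    between them in either order.\<close>
  moreover have "?G x x1 x2 n"
    if "n \<ge> 2" "path_dist adj x x1 = enat n" "path_dist adj x x2 = enat n"
      and "adj x1 z" "adj x2 z" "path_dist adj x z = enat (n + 1)" for x x1 x2 z n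
    using that quadrangle_below[of x x1 n x2 z] quadrangle_above[of x x1 n x2 z]
      quadrangle_between[of x x1 n x2 z] quadrangle_between[of x x2 n x1 z]
    unfolding path_dist_height[of x] interval_adj_def by auto
  moreover have "path_dist adj x y < \<infinity>" for x y
    by (simp add: path_dist_height)
  ultimately show ?thesis
    using symp_adj irreflp_adj
    unfolding weakly_modular_graph_def simplicial_graph_def triangle_condition_def
      quadrangle_condition_def by blast
qed

end

theorem theorem3p1:
  fixes act :: "'a::lattice \<Rightarrow> int \<Rightarrow> 'a" (infixl "\<oplus>" 65)
  assumes joins: "\<And>A :: 'a set. A \<noteq> {} \<Longrightarrow> bdd_above A \<Longrightarrow> \<exists>s. isLub UNIV A s"
    and action: "int_action (\<oplus>)"
    and order_preserving: "\<And>n. mono (\<lambda>x. x \<oplus> n)"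
    and increasing: "\<And>x. x \<le> x \<oplus> 1"
    and cofinal: "\<And>x y. \<exists>k::nat. x \<oplus> (- int k) \<le> y \<and> y \<le> x \<oplus> int k"
  shows "weakly_modular_graph (interval_adj (\<oplus>))"
proof -
  interpret lattice_int_action act
    using assms(2-5) by unfold_locales
  show ?thesis by (rule weakly_modular)
qed

end
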